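(* Assume $\max\{\|f\|_\infty,\|f_1\|_\infty,\dots,\|f_N\|_\infty\}=:L<\infty$ and let $\gamma_0=\varepsilon\sqrt{\ln N}<L$. Let $$\Psi=\overline\Psi_{I_N}(\gamma_0):=\Big\{\psi_g(\cdot)=\frac{[|g(\cdot)|-\|g\|_\infty+\gamma_0]_+\operatorname{sign}\{g(\cdot)\}}{\int[|g(t)|-\|g\|_\infty+\gamma_0]_+\,dt}\ :\ g=f_i-f_j,\ i,j\in I_N,\ i\ne j\Big\},$$ where $[\cdot]_+=\max\{\cdot,0\}$. Let $\varkappa:=\min\{\varkappa>0:\mathbb{P}[\max_{\psi\in\Psi}|Z(\psi)|/\|\psi\|_2\ge\varkappa]\le\varepsilon\}$, and let $\hat f=f_{\hat i}$ with $$\hat i:=\arg\min_{i\in I_N}\hat M_i,\qquad \hat M_i:=\max_{\psi\in\Psi}\Big\{\frac{1}{\|\psi\|_1}\big[|\Delta_i(\psi)|-\varepsilon\varkappa\|\psi\|_2\big]\Big\}.$$ Let $i_*:=\arg\min_{i\in I_N}\|f-f_i\|_\infty$. Then $$\mathcal{R}_\infty[\hat f;f]\le3\min_{i\in I_N}\|f_i-f\|_\infty+3Q_4(\gamma_0)\,\varepsilon\sqrt{2\ln\frac{N^2}{\varepsilon}}+2L\varepsilon,$$ where $$Q_4(\gamma):=\max_{i\in I_N,\ i\ne i_*}\frac{\|S_{i_*i}(\cdot,\gamma)\|_2}{\|S_{i_*i}(\cdot,\gamma)\|_1},\qquad S_{i_*i}(\cdot,\gamma):=\big[|f_{i_*}(\cdot)-f_i(\cdot)|-\|f_{i_*}-f_i\|_\infty+\gamma\big]_+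 .$$
   Context: Model: $\mathcal{D}_0=[0,1]^d$, $\varepsilon\in(0,1)$, and one observes $\mathcal{Y}_\varepsilon$ in the Gaussian white noise model $Y_\varepsilon(dt)=f(t)\,dt+\varepsilon W(dt)$, $t\in\mathcal{D}_0$, with $f$ an unknown real function and $W$ the standard Wiener process in $\mathbb{R}^d$. Thus for a probe function $\psi\in\mathbb{L}_2(\mathcal{D}_0)$ one observes $\int\psi(t)Y_\varepsilon(dt)=\int\psi f\,dt+\varepsilon Z(\psi)$, where $Z(\psi)=\int\psi(t)W(dt)$ is the zero-mean Gaussian process, linear in $\psi$, with $\mathbb{E}[Z(\psi)Z(\phi)]=\int\psi\phi\,dt$. $\|\cdot\|_p$ is the $\mathbb{L}_p$-norm on $\mathcal{D}_0$ (Lebesgue measure); the risk of an estimator $\tilde f$ is $\mathcal{R}_\infty[\tilde f;f]:=\mathbb{E}_f\|\tilde f-f\|_\infty$, with $\mathbb{E}_f$ the expectation under the model with signal $f$. Family: $I_N=\{1,\dots,N\}$, $N\ge2$, and $f_1,\dots,f_N$ are distinct fixed (nonrandom) functions on $\mathcal{D}_0$. For a probe function $\psi$, $\Delta_i(\psi):=\int\psi(t)Y_\varepsilon(dt)-\int\psi(t)f_i(t)\,dt=\int\psi(t)[f(t)-f_i(t)]\,dt+\varepsilon Z(\psi)$. Conventions: ties in $\arg\min$ are broken arbitrarily (measurably); $\operatorname{sign}(0)=0$. *)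

theory Defs
  imports "HOL-Probability.Probability"
begin

section \<open>Function norms on the unit cube\<close>

abbreviation unit_cube :: "(real^'d) set" where
  "unit_cube \<equiv> cbox 0 1"

abbreviation cube_measure :: "(real^'d) measure" where
  "cube_measure \<equiv> lebesgue_on unit_cube"

definition Linf_ext :: "(real^'d \<Rightarrow> real) \<Rightarrow> ereal" where
  "Linf_ext g = esssup cube_measure (\<lambda>t. ereal \<bar>g t\<bar>)"

text \<open>Real-valued version of the essential supremum norm; meaningful only if
  \<^term>\<open>Linf_ext g\<close> is finite.\<close>

definition Linf :: "(real^'d \<Rightarrow> real) \<Rightarrow> real" where
  "Linf g = real_of_ereal (Linf_ext g)"

definition L1norm :: "(real^'d \<Rightarrow> real) \<Rightarrow> real" where
  "L1norm g = (LINT t|cube_measure. \<bar>g t\<bar>)"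

definition L2norm :: "(real^'d \<Rightarrow> real) \<Rightarrow> real" where
  "L2norm g = sqrt (LINT t|cube_measure. (g t)\<^sup>2)"

definition L2_space :: "(real^'d \<Rightarrow> real) set" where
  "L2_space = {g \<in> borel_measurable cube_measure. integrable cube_measure (\<lambda>t. (g t)\<^sup>2)}"

section \<open>Gaussian white noise\<close>

text \<open>Point masses count as (degenerate) normal laws. Joint Gaussianity of the
  finite-dimensional distributions is expressed through linear combinations.\<close>

definition gaussian_rv :: "'w measure \<Rightarrow> ('w \<Rightarrow> real) \<Rightarrow> bool" where
  "gaussian_rv P X \<longleftrightarrow>
     X \<in> borel_measurable P \<and>
     ((\<exists>\<mu> \<sigma>. \<sigma> > 0 \<and> distributed P lborel X (normal_density \<mu> \<sigma>)) \<or>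
      (\<exists>\<mu>. AE \<omega> in P. X \<omega> = \<mu>))"

definition gaussian_process :: "'w measure \<Rightarrow> 'i set \<Rightarrow> ('i \<Rightarrow> 'w \<Rightarrow> real) \<Rightarrow> bool" where
  "gaussian_process P T X \<longleftrightarrow>
     (\<forall>J a. finite J \<longrightarrow> J \<subseteq> T \<longrightarrow> gaussian_rv P (\<lambda>\<omega>. \<Sum>j\<in>J. a j * X j \<omega>))"

text \<open>The process \<open>Z \<psi> = \<integral> \<psi> dW\<close> of Wiener integrals, through its characterisation as the
  zero-mean Gaussian process on \<open>L\<^sub>2\<close>, linear in \<open>\<psi>\<close> (almost surely, as \<open>Z \<psi>\<close> is
  defined only up to null sets), with the \<open>L\<^sub>2\<close> inner product as covariance.\<close>

definition white_noise :: "'w measure \<Rightarrow> ((real^'d \<Rightarrow> real) \<Rightarrow> 'w \<Rightarrow> real) \<Rightarrow> bool" where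
  "white_noise P Z \<longleftrightarrow>
     prob_space P \<and>
     gaussian_process P L2_space Z \<and>
     (\<forall>\<psi>\<in>L2_space. prob_space.expectation P (Z \<psi>) = 0) \<and>
     (\<forall>\<psi>\<in>L2_space. \<forall>\<phi>\<in>L2_space. \<forall>a b.
        AE \<omega> in P. Z (\<lambda>t. a * \<psi> t + b * \<phi> t) \<omega> = a * Z \<psi> \<omega> + b * Z \<phi> \<omega>) \<and>
     (\<forall>\<psi>\<in>L2_space. \<forall>\<phi>\<in>L2_space.
        prob_space.expectation P (\<lambda>\<omega>. Z \<psi> \<omega> * Z \<phi> \<omega>) = (LINT t|cube_measure. \<psi> t * \<phi> t))"

text \<open>The observation \<open>\<integral> \<psi>(t) Y(dt)\<close> under the signal \<open>f\<close> at noise level \<open>\<epsilon>\<close>.\<close>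

definition observation ::
  "((real^'d \<Rightarrow> real) \<Rightarrow> 'w \<Rightarrow> real) \<Rightarrow> real \<Rightarrow> (real^'d \<Rightarrow> real) \<Rightarrow> (real^'d \<Rightarrow> real) \<Rightarrow> 'w \<Rightarrow> real" where
  "observation Z \<epsilon> f \<psi> \<omega> = (LINT t|cube_measure. \<psi> t * f t) + \<epsilon> * Z \<psi> \<omega>"

definition Linf_risk ::
  "'w measure \<Rightarrow> ('w \<Rightarrow> real^'d \<Rightarrow> real) \<Rightarrow> (real^'d \<Rightarrow> real) \<Rightarrow> real" where
  "Linf_risk P fhat f = prob_space.expectation P (\<lambda>\<omega>. Linf (\<lambda>t. fhat \<omega> t - f t))"

section \<open>Probe functions and the selection rule\<close>

text \<open>The truncation \<open>[|g| - \<parallel>g\<parallel>\<^sub>\<infinity> + \<gamma>]\<^sub>+\<close>, which enters both the probe functions and \<open>Q\<^sub>4\<close>.\<close>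

definition trunc :: "real \<Rightarrow> (real^'d \<Rightarrow> real) \<Rightarrow> real^'d \<Rightarrow> real" where
  "trunc \<gamma> g t = max (\<bar>g t\<bar> - Linf g + \<gamma>) 0"

definition probe :: "real \<Rightarrow> (real^'d \<Rightarrow> real) \<Rightarrow> real^'d \<Rightarrow> real" where
  "probe \<gamma> g t = trunc \<gamma> g t * sgn (g t) / (LINT s|cube_measure. trunc \<gamma> g s)"

definition probe_set :: "nat set \<Rightarrow> (nat \<Rightarrow> real^'d \<Rightarrow> real) \<Rightarrow> real \<Rightarrow> (real^'d \<Rightarrow> real) set" where
  "probe_set I fs \<gamma> = {probe \<gamma> (\<lambda>t. fs i t - fs j t) | i j. i \<in> I \<and> j \<in> I \<and> i \<noteq> j}"

definition noise_quantile ::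
  "'w measure \<Rightarrow> ((real^'d \<Rightarrow> real) \<Rightarrow> 'w \<Rightarrow> real) \<Rightarrow> (real^'d \<Rightarrow> real) set \<Rightarrow> real \<Rightarrow> real" where
  "noise_quantile P Z \<Psi> \<epsilon> =
     (LEAST \<kappa>. \<kappa> > 0 \<and>
        prob_space.prob P {\<omega> \<in> space P. Max ((\<lambda>\<psi>. \<bar>Z \<psi> \<omega>\<bar> / L2norm \<psi>) ` \<Psi>) \<ge> \<kappa>} \<le> \<epsilon>)"

definition Delta ::
  "((real^'d \<Rightarrow> real) \<Rightarrow> 'w \<Rightarrow> real) \<Rightarrow> real \<Rightarrow> (real^'d \<Rightarrow> real) \<Rightarrow> (real^'d \<Rightarrow> real)
     \<Rightarrow> (real^'d \<Rightarrow> real) \<Rightarrow> 'w \<Rightarrow> real" where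
  "Delta Z \<epsilon> f h \<psi> \<omega> = observation Z \<epsilon> f \<psi> \<omega> - (LINT t|cube_measure. \<psi> t * h t)"

definition Mhat ::
  "((real^'d \<Rightarrow> real) \<Rightarrow> 'w \<Rightarrow> real) \<Rightarrow> real \<Rightarrow> (real^'d \<Rightarrow> real) \<Rightarrow> (real^'d \<Rightarrow> real) set
     \<Rightarrow> real \<Rightarrow> (real^'d \<Rightarrow> real) \<Rightarrow> 'w \<Rightarrow> real" where
  "Mhat Z \<epsilon> f \<Psi> \<kappa> h \<omega> =
     Max ((\<lambda>\<psi>. 1 / L1norm \<psi> * (\<bar>Delta Z \<epsilon> f h \<psi> \<omega>\<bar> - \<epsilon> * \<kappa> * L2norm \<psi>)) ` \<Psi>)"

definition Q4 :: "nat set \<Rightarrow> (nat \<Rightarrow> real^'d \<Rightarrow> real) \<Rightarrow> nat \<Rightarrow> real \<Rightarrow> real" where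
  "Q4 I fs istar \<gamma> =
     Max ((\<lambda>i. L2norm (trunc \<gamma> (\<lambda>t. fs istar t - fs i t)) /
               L1norm (trunc \<gamma> (\<lambda>t. fs istar t - fs i t))) ` (I - {istar}))"

end

theory Submission
  imports Defs
begin

text \<open>
  Two deterministic properties of the probes carry the theorem. The probe \<open>\<psi>\<close> of
  \<open>g = f\<^sub>i - f\<^sub>j\<close> has \<open>L\<^sub>1\<close> norm at most \<open>1\<close> and lives where \<open>\<bar>g\<bar>\<close> is within \<open>\<gamma>\<close> of its
  supremum, so that \<open>\<integral> \<psi> g \<ge> \<parallel>g\<parallel>\<^sub>\<infinity> - \<gamma>\<close> (\<open>integral_probe_ge\<close>): it recovers the supremum norm
  of \<open>g\<close> up to \<open>\<gamma>\<close>. Conversely, \<open>\<bar>\<integral> \<psi> h\<bar> \<le> \<parallel>\<psi>\<parallel>\<^sub>1 \<parallel>h\<parallel>\<^sub>\<infinity>\<close> for every \<open>h\<close>.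

  Suppose that \<open>\<bar>Z \<psi>\<bar> \<le> \<kappa> \<parallel>\<psi>\<parallel>\<^sub>2\<close> for all probes. Then the statistic of the oracle index \<open>s\<close> is at
  most the oracle loss \<open>B\<close> (\<open>Mhat_le_Linf\<close>), hence so is that of the selected index \<open>i\<close>. Testing
  with the probe of \<open>g = f\<^sub>s - f\<^sub>i\<close>, the difference of the two residuals is \<open>\<integral> \<psi> g\<close>, whence
  \<open>\<parallel>g\<parallel>\<^sub>\<infinity> \<le> 2 B + \<gamma> + 2 \<epsilon> \<kappa> \<parallel>\<psi>\<parallel>\<^sub>2\<close> (\<open>selected_close_to_oracle\<close>). The triangle inequality gives the
  loss bound \<open>3 B + \<gamma> + 2 \<epsilon> \<kappa> Q\<^sub>4\<close>, because \<open>\<parallel>\<psi>\<parallel>\<^sub>2\<close> is at most the ratio of norms in \<open>Q\<^sub>4\<close>.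
  As \<open>Q\<^sub>4 \<ge> 1\<close> by Cauchy-Schwarz and \<open>\<gamma>\<^sub>0 = \<epsilon> sqrt (ln N)\<close> lies below
  \<open>\<epsilon> sqrt (2 ln (N\<^sup>2 / \<epsilon>))\<close>, the term \<open>\<gamma>\<^sub>0\<close> turns the factor \<open>2\<close> of the noise term into a \<open>3\<close>.

  The noise event fails with probability at most \<open>\<epsilon>\<close> by the choice of \<open>\<kappa>\<close>, and then the loss is
  still at most \<open>2 L\<close>. Finally \<open>\<kappa> \<le> sqrt (2 ln (N\<^sup>2 / \<epsilon>))\<close> follows from a union bound over at most
  \<open>N\<^sup>2\<close> probes with the Gaussian tail bound \<open>exp (- x\<^sup>2 / 2)\<close> (\<open>white_noise_quantile\<close>); the minimum
  defining \<open>\<kappa>\<close> is attained because the maximum of the normalised noise has no atoms on the positive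
  half-line. This minimum exists only if some probe is not a null function. If all probes are null
  functions, then all the \<open>f\<^sub>i\<close> agree almost everywhere, and every selection has the oracle loss.
\<close>

section \<open>Essentially bounded functions on the cube\<close>

lemma prob_space_cube: "prob_space (cube_measure :: (real^'d) measure)"
proof
  have "emeasure lborel (unit_cube :: (real^'d) set) = ennreal (measure lborel (unit_cube :: (real^'d) set))"
    by (rule emeasure_eq_ennreal_measure) (use emeasure_lborel_cbox_finite in \<open>auto simp: less_top\<close>)
  also have "measure lborel (unit_cube :: (real^'d) set) = 1"
    by (subst content_cbox_cart) (auto simp: interval_ne_empty_cart)
  finally show "emeasure (cube_measure :: (real^'d) measure) (space cube_measure) = 1"
    by (simp add: emeasure_restrict_space space_restrict_space)
qed

interpretation cube: prob_space "cube_measure :: (real^'d) measure"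
  by (rule prob_space_cube)

text \<open>Boundedness by a real constant instead of finiteness of the extended norm: this form passes
  through sums and products directly. The two are equivalent by \<open>ess_bounded_iff_Linf_ext\<close>.\<close>

definition ess_bounded :: "(real^'d \<Rightarrow> real) \<Rightarrow> bool" where
  "ess_bounded g \<longleftrightarrow> g \<in> borel_measurable cube_measure \<and> (\<exists>C. AE t in cube_measure. \<bar>g t\<bar> \<le> C)"

lemma ess_bounded_measurable: "ess_bounded g \<Longrightarrow> g \<in> borel_measurable cube_measure"
  by (simp add: ess_bounded_def)

text \<open>The essential supremum over a null space would be \<open>-\<infinity>\<close>; the cube has positive measure.\<close>

lemma Linf_ext_nonneg:
  fixes g :: "real^'d \<Rightarrow> real"
  shows "0 \<le> Linf_ext g"
proof -
  have "AE t in cube_measure. ereal \<bar>g t\<bar> \<le> Linf_ext g"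
    unfolding Linf_ext_def by (rule esssup_AE)
  then have "AE t::real^'d in cube_measure. 0 \<le> Linf_ext g"
    by (rule AE_mp) (rule AE_I2, metis abs_ge_zero ereal_less_eq(5) order_trans)
  then show ?thesis by (simp add: cube.AE_const)
qed

lemma Linf_nonneg: "0 \<le> Linf g"
  unfolding Linf_def by (intro real_of_ereal_pos Linf_ext_nonneg)

lemma Linf_ext_le:
  assumes "g \<in> borel_measurable cube_measure" "AE t in cube_measure. \<bar>g t\<bar> \<le> C"
  shows "Linf_ext g \<le> ereal C"
  unfolding Linf_ext_def using assms by (intro esssup_I) auto

lemma Linf_le:
  assumes "g \<in> borel_measurable cube_measure" "AE t in cube_measure. \<bar>g t\<bar> \<le> C"
  shows "Linf g \<le> C"
  using Linf_ext_le[OF assms] Linf_ext_nonneg[of g] unfolding Linf_def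
  by (metis real_of_ereal.simps(1) real_of_ereal_positive_mono PInfty_neq_ereal(1))

lemma ereal_Linf: "ess_bounded g \<Longrightarrow> ereal (Linf g) = Linf_ext g"
  using Linf_ext_le[of g] Linf_ext_nonneg[of g]
  unfolding ess_bounded_def Linf_def by (auto simp: ereal_real)

lemma ess_bounded_AE:
  assumes "ess_bounded g"
  shows "AE t in cube_measure. \<bar>g t\<bar> \<le> Linf g"
proof -
  have "AE t in cube_measure. ereal \<bar>g t\<bar> \<le> Linf_ext g"
    unfolding Linf_ext_def by (rule esssup_AE)
  then show ?thesis by (simp flip: ereal_Linf[OF assms])
qed

lemma ess_bounded_iff_Linf_ext:
  "ess_bounded g \<longleftrightarrow> g \<in> borel_measurable cube_measure \<and> Linf_ext g < \<infinity>"
proof safe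
  assume "ess_bounded g"
  then show "g \<in> borel_measurable cube_measure" "Linf_ext g < \<infinity>"
    by (simp_all add: ess_bounded_measurable flip: ereal_Linf)
next
  assume m: "g \<in> borel_measurable cube_measure" and "Linf_ext g < \<infinity>"
  then obtain C where C: "Linf_ext g = ereal C"
    using Linf_ext_nonneg[of g] by (cases "Linf_ext g") auto
  have "AE t in cube_measure. ereal \<bar>g t\<bar> \<le> Linf_ext g"
    unfolding Linf_ext_def by (rule esssup_AE)
  with C m show "ess_bounded g" unfolding ess_bounded_def by auto
qed

lemma ess_boundedI:
  assumes "g \<in> borel_measurable cube_measure" "AE t in cube_measure. \<bar>g t\<bar> \<le> C"
  shows "ess_bounded g"
  using assms by (auto simp: ess_bounded_def)

lemma ess_bounded_diff:
  assumes "ess_bounded g" "ess_bounded h"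
  shows "ess_bounded (\<lambda>t. g t - h t)"
    and Linf_diff_le: "Linf (\<lambda>t. g t - h t) \<le> Linf g + Linf h"
proof -
  have "AE t in cube_measure. \<bar>g t - h t\<bar> \<le> Linf g + Linf h"
    using ess_bounded_AE[OF assms(1)] ess_bounded_AE[OF assms(2)] by eventually_elim linarith
  then show "ess_bounded (\<lambda>t. g t - h t)" "Linf (\<lambda>t. g t - h t) \<le> Linf g + Linf h"
    using assms[THEN ess_bounded_measurable] by (auto intro!: ess_boundedI Linf_le)
qed

lemma Linf_diff_commute: "Linf (\<lambda>t. g t - h t) = Linf (\<lambda>t. h t - g t)"
  by (simp add: Linf_def Linf_ext_def abs_minus_commute)

lemma Linf_diff_triangle:
  assumes "ess_bounded f" "ess_bounded g" "ess_bounded h"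
  shows "Linf (\<lambda>t. f t - h t) \<le> Linf (\<lambda>t. f t - g t) + Linf (\<lambda>t. g t - h t)"
  using Linf_diff_le[OF ess_bounded_diff(1)[OF assms(1,2)] ess_bounded_diff(1)[OF assms(3,2)]]
  unfolding Linf_diff_commute[of h g] by simp

lemma integrable_ess_bounded:
  assumes "ess_bounded g"
  shows "integrable cube_measure g"
  using ess_bounded_AE[OF assms] ess_bounded_measurable[OF assms]
  by (intro cube.integrable_const_bound[where B="Linf g"]) auto

lemma ess_bounded_mult:
  assumes "ess_bounded g" "ess_bounded h"
  shows "ess_bounded (\<lambda>t. g t * h t)"
proof (rule ess_boundedI)
  show "AE t in cube_measure. \<bar>g t * h t\<bar> \<le> Linf g * Linf h"
    using ess_bounded_AE[OF assms(1)] ess_bounded_AE[OF assms(2)]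
    by eventually_elim (simp add: abs_mult mult_mono Linf_nonneg)
qed (use assms[THEN ess_bounded_measurable] in auto)

lemma ess_bounded_abs: "ess_bounded g \<Longrightarrow> ess_bounded (\<lambda>t. \<bar>g t\<bar>)"
  by (auto simp: ess_bounded_def)

lemma ess_bounded_const: "ess_bounded (\<lambda>t. c)"
  by (rule ess_boundedI[where C="\<bar>c\<bar>"]) auto

lemmas ess_bounded_intros = ess_bounded_const ess_bounded_abs ess_bounded_mult ess_bounded_diff(1)

lemma ess_bounded_L2_space: "ess_bounded g \<Longrightarrow> g \<in> L2_space"
  using integrable_ess_bounded[OF ess_bounded_mult[of g g]]
  by (auto simp: L2_space_def ess_bounded_measurable power2_eq_square)

lemma L1norm_nonneg: "0 \<le> L1norm g"
  by (simp add: L1norm_def)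

lemma L2norm_nonneg: "0 \<le> L2norm g"
  by (simp add: L2norm_def)

text \<open>The cube has volume one, so the variance of \<open>\<bar>g\<bar>\<close> is the gap in Cauchy-Schwarz.\<close>

lemma L1norm_le_L2norm:
  assumes "ess_bounded g"
  shows "L1norm g \<le> L2norm g"
proof -
  have "cube.variance (\<lambda>t. \<bar>g t\<bar>) = (LINT t|cube_measure. (g t)\<^sup>2) - (L1norm g)\<^sup>2"
    using integrable_ess_bounded[OF ess_bounded_abs[OF assms]] ess_bounded_L2_space[OF assms]
    by (subst cube.variance_eq) (simp_all add: L1norm_def L2_space_def)
  then have "(L1norm g)\<^sup>2 \<le> (LINT t|cube_measure. (g t)\<^sup>2)"
    using cube.variance_positive[of "\<lambda>t. \<bar>g t\<bar>"] by linarith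
  then show ?thesis unfolding L2norm_def by (rule real_le_rsqrt)
qed

lemma abs_integral_mult_le:
  assumes "ess_bounded \<psi>" "ess_bounded h"
  shows "\<bar>LINT t|cube_measure. \<psi> t * h t\<bar> \<le> L1norm \<psi> * Linf h"
proof -
  have "\<bar>LINT t|cube_measure. \<psi> t * h t\<bar> \<le> (LINT t|cube_measure. \<bar>\<psi> t * h t\<bar>)"
    using integral_abs_bound .
  also have "\<dots> \<le> (LINT t|cube_measure. \<bar>\<psi> t\<bar> * Linf h)"
  proof (rule integral_mono_AE)
    show "AE t in cube_measure. \<bar>\<psi> t * h t\<bar> \<le> \<bar>\<psi> t\<bar> * Linf h"
      using ess_bounded_AE[OF assms(2)] by eventually_elim (simp add: abs_mult mult_left_mono)
  qed (intro integrable_ess_bounded ess_bounded_intros assms)+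
  finally show ?thesis by (simp add: L1norm_def)
qed

section \<open>Truncations and probe functions\<close>

lemma trunc_nonneg: "0 \<le> trunc \<gamma> g t"
  by (simp add: trunc_def)

lemma L1norm_trunc: "L1norm (trunc \<gamma> g) = (LINT s|cube_measure. trunc \<gamma> g s)"
  by (simp add: L1norm_def trunc_nonneg)

lemma ess_bounded_trunc:
  assumes "ess_bounded g" 
  shows "ess_bounded (trunc \<gamma> g)"
proof (rule ess_boundedI)
  show "AE t in cube_measure. \<bar>trunc \<gamma> g t\<bar> \<le> \<bar>\<gamma>\<bar>"
    using ess_bounded_AE[OF assms] by eventually_elim (auto simp: trunc_def)
  show "trunc \<gamma> g \<in> borel_measurable cube_measure"
    using ess_bounded_measurable[OF assms] unfolding trunc_def[abs_def] by simp
qed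

text \<open>A null truncation would make \<open>\<parallel>g\<parallel>\<^sub>\<infinity> - \<gamma>\<close> an essential bound of \<open>g\<close>.\<close>

lemma L1norm_trunc_pos:
  assumes g: "ess_bounded g" and "0 < \<gamma>"
  shows "0 < L1norm (trunc \<gamma> g)"
proof (rule ccontr)
  assume "\<not> ?thesis"
  then have "(LINT s|cube_measure. trunc \<gamma> g s) = 0"
    using L1norm_nonneg[of "trunc \<gamma> g"] by (simp add: L1norm_trunc)
  then have "AE t in cube_measure. trunc \<gamma> g t = 0"
    by (subst (asm) integral_nonneg_eq_0_iff_AE)
      (auto simp: trunc_nonneg intro: integrable_ess_bounded ess_bounded_trunc g)
  then have "AE t in cube_measure. \<bar>g t\<bar> \<le> Linf g - \<gamma>"
    by eventually_elim (auto simp: trunc_def max_def split: if_splits)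
  from Linf_le[OF ess_bounded_measurable[OF g] this] show False using \<open>0 < \<gamma>\<close> by simp
qed

lemma ess_bounded_sgn:
  assumes "g \<in> borel_measurable cube_measure"
  shows "ess_bounded (\<lambda>t. sgn (g t))"
  using assms by (intro ess_boundedI[where C=1]) (auto simp: sgn_if)

lemma probe_eq: "probe \<gamma> g = (\<lambda>t. trunc \<gamma> g t * sgn (g t) * (1 / L1norm (trunc \<gamma> g)))"
  by (simp add: probe_def[abs_def] L1norm_trunc)

lemma ess_bounded_probe:
  assumes "ess_bounded g"
  shows "ess_bounded (probe \<gamma> g)"
  unfolding probe_eq
  by (intro ess_bounded_intros ess_bounded_trunc ess_bounded_sgn ess_bounded_measurable assms)

lemma abs_probe_le: "\<bar>probe \<gamma> g t\<bar> \<le> trunc \<gamma> g t / L1norm (trunc \<gamma> g)"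
  by (simp add: probe_eq abs_mult trunc_nonneg L1norm_nonneg abs_sgn_eq divide_nonneg_nonneg)

text \<open>Equality can fail: where \<open>g\<close> vanishes the probe does too, while the truncation is positive
  there if \<open>\<parallel>g\<parallel>\<^sub>\<infinity> < \<gamma>\<close>.\<close>

lemma L1norm_probe_le_1:
  assumes "ess_bounded g" "0 < \<gamma>"
  shows "L1norm (probe \<gamma> g) \<le> 1"
proof -
  have "L1norm (probe \<gamma> g) \<le> (LINT t|cube_measure. trunc \<gamma> g t / L1norm (trunc \<gamma> g))"
    unfolding L1norm_def[of "probe \<gamma> g"]
    by (intro integral_mono integrable_divide[OF integrable_ess_bounded] integrable_ess_bounded[OF ess_bounded_abs]
        ess_bounded_probe assms ess_bounded_trunc abs_probe_le)
  also have "\<dots> = 1"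
    using L1norm_trunc_pos[OF assms] by (simp flip: L1norm_trunc)
  finally show ?thesis .
qed

lemma L2norm_probe_le:
  assumes "ess_bounded g"
  shows "L2norm (probe \<gamma> g) \<le> L2norm (trunc \<gamma> g) / L1norm (trunc \<gamma> g)"
proof -
  let ?c = "L1norm (trunc \<gamma> g)"
  have "(LINT t|cube_measure. (probe \<gamma> g t)\<^sup>2) \<le> (LINT t|cube_measure. (trunc \<gamma> g t)\<^sup>2 / ?c\<^sup>2)"
  proof (rule integral_mono)
    show "integrable cube_measure (\<lambda>t. (probe \<gamma> g t)\<^sup>2)"
      using ess_bounded_L2_space[OF ess_bounded_probe[OF assms]] by (simp add: L2_space_def)
    show "integrable cube_measure (\<lambda>t. (trunc \<gamma> g t)\<^sup>2 / ?c\<^sup>2)"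
      using ess_bounded_L2_space[OF ess_bounded_trunc[OF assms]] by (simp add: L2_space_def)
    show "(probe \<gamma> g t)\<^sup>2 \<le> (trunc \<gamma> g t)\<^sup>2 / ?c\<^sup>2" for t
      using power_mono[OF abs_probe_le[of \<gamma> g t], of 2] by (simp add: power_divide)
  qed
  also have "\<dots> = (LINT t|cube_measure. (trunc \<gamma> g t)\<^sup>2) / ?c\<^sup>2" by simp
  finally have "sqrt (LINT t|cube_measure. (probe \<gamma> g t)\<^sup>2)
      \<le> sqrt ((LINT t|cube_measure. (trunc \<gamma> g t)\<^sup>2) / ?c\<^sup>2)" by simp
  then show ?thesis by (simp add: L2norm_def real_sqrt_divide L1norm_nonneg)
qed

text \<open>The product of the probe with \<open>g\<close> is \<open>\<bar>g\<bar>\<close> averaged against the normalised truncation, whose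
  support is contained in the set where \<open>\<bar>g\<bar> \<ge> \<parallel>g\<parallel>\<^sub>\<infinity> - \<gamma>\<close>.\<close>

lemma integral_probe_ge:
  assumes g: "ess_bounded g" and "0 < \<gamma>"
  shows "Linf g - \<gamma> \<le> (LINT t|cube_measure. probe \<gamma> g t * g t)"
proof -
  let ?c = "L1norm (trunc \<gamma> g)"
  have c: "0 < ?c" by (rule L1norm_trunc_pos[OF assms])
  have "Linf g - \<gamma> = (LINT t|cube_measure. (Linf g - \<gamma>) * (trunc \<gamma> g t * (1 / ?c)))"
    using c by (simp flip: L1norm_trunc)
  also have "\<dots> \<le> (LINT t|cube_measure. probe \<gamma> g t * g t)"
  proof (rule integral_mono)
    show "integrable cube_measure (\<lambda>t. (Linf g - \<gamma>) * (trunc \<gamma> g t * (1 / ?c)))"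
      by (intro integrable_ess_bounded ess_bounded_intros ess_bounded_trunc g)
    show "integrable cube_measure (\<lambda>t. probe \<gamma> g t * g t)"
      by (intro integrable_ess_bounded ess_bounded_mult ess_bounded_probe g)
    fix t
    have "(Linf g - \<gamma>) * trunc \<gamma> g t \<le> \<bar>g t\<bar> * trunc \<gamma> g t"
      by (cases "trunc \<gamma> g t = 0")
        (auto intro!: mult_right_mono simp: trunc_nonneg, auto simp: trunc_def max_def split: if_splits)
    then have "(Linf g - \<gamma>) * trunc \<gamma> g t / ?c \<le> \<bar>g t\<bar> * trunc \<gamma> g t / ?c"
      using c by (intro divide_right_mono) auto
    also have "\<dots> = probe \<gamma> g t * g t"
      by (simp add: probe_eq abs_sgn mult_ac)
    finally show "(Linf g - \<gamma>) * (trunc \<gamma> g t * (1 / ?c)) \<le> probe \<gamma> g t * g t" by simp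
  qed
  finally show ?thesis .
qed

text \<open>If the probe vanishes, then \<open>\<bar>g\<bar>\<close> is either zero or at most \<open>\<parallel>g\<parallel>\<^sub>\<infinity> - \<gamma>\<close> almost everywhere, and a
  nonzero \<open>g\<close> would have an essential bound below its norm. This covers the
  probes for which the division by \<open>\<parallel>\<psi>\<parallel>\<^sub>1\<close> in the statistic is degenerate.\<close>

lemma Linf_eq_0_if_probe_null:
  assumes g: "ess_bounded g" and "0 < \<gamma>" and "L1norm (probe \<gamma> g) = 0"
  shows "Linf g = 0"
proof -
  have "AE t in cube_measure. \<bar>probe \<gamma> g t\<bar> = 0"
    using assms(3) unfolding L1norm_def
    by (subst (asm) integral_nonneg_eq_0_iff_AE)
      (auto intro!: integrable_ess_bounded ess_bounded_abs ess_bounded_probe g)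
  then have "AE t in cube_measure. \<bar>g t\<bar> \<le> max 0 (Linf g - \<gamma>)"
  proof eventually_elim
    case (elim t)
    then have "trunc \<gamma> g t = 0 \<or> g t = 0"
      using L1norm_trunc_pos[OF assms(1,2)] by (auto simp: probe_eq sgn_zero_iff)
    then show ?case by (auto simp: trunc_def max_def split: if_splits)
  qed
  from Linf_le[OF ess_bounded_measurable[OF g] this] show ?thesis
    using Linf_nonneg[of g] \<open>0 < \<gamma>\<close> by (simp add: max_def split: if_splits)
qed

section \<open>Gaussian tails\<close>

lemma normal_density_shift_le:
  assumes "0 \<le> x" "0 \<le> s"
  shows "std_normal_density (x + s) \<le> exp (- x\<^sup>2 / 2) * std_normal_density s"
proof -
  have "- (x + s)\<^sup>2 / 2 \<le> - x\<^sup>2 / 2 + - s\<^sup>2 / 2"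
    using assms by (simp add: power2_sum)
  then have "exp (- (x + s)\<^sup>2 / 2) \<le> exp (- x\<^sup>2 / 2) * exp (- s\<^sup>2 / 2)"
    by (simp flip: exp_add)
  then show ?thesis
    by (simp add: std_normal_density_def divide_right_mono)
qed

text \<open>Each of the two half-line tails, shifted by \<open>x\<close> to the origin, is at most \<open>exp (- x\<^sup>2 / 2)\<close>
  times the mass of a half-line. The two half-lines together have mass one, so there is no
  leading factor \<open>2\<close>, which would reappear inside the logarithm that bounds the noise quantile.\<close>

lemma (in prob_space) std_normal_tail:
  assumes X: "distributed M lborel X std_normal_density" and x: "0 \<le> x"
  shows "prob {\<omega> \<in> space M. x \<le> \<bar>X \<omega>\<bar>} \<le> exp (- x\<^sup>2 / 2)"
proof -
  let ?d = "\<lambda>t. ennreal (std_normal_density t)"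
  let ?e = "ennreal (exp (- (x\<^sup>2 / 2)))"
  have shift: "?d (x + s) \<le> ?e * ?d s" if "0 \<le> s" for s
    using normal_density_shift_le[OF x that] by (simp flip: ennreal_mult)
  have even: "?d (- s) = ?d s" for s by (simp add: std_normal_density_def)
  have right: "(\<integral>\<^sup>+t. ?d t * indicator {x..} t \<partial>lborel) \<le> ?e * (\<integral>\<^sup>+s. ?d s * indicator {0..} s \<partial>lborel)"
  proof -
    have "(\<integral>\<^sup>+t. ?d t * indicator {x..} t \<partial>lborel) = (\<integral>\<^sup>+s. ?d (x + s) * indicator {x..} (x + s) \<partial>lborel)"
      using nn_integral_real_affine[of "\<lambda>t. ?d t * indicator {x..} t" 1 x] by simp
    also have "\<dots> \<le> (\<integral>\<^sup>+s. ?e * (?d s * indicator {0..} s) \<partial>lborel)"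
      by (intro nn_integral_mono) (auto split: split_indicator simp: shift)
    finally show ?thesis by (simp add: nn_integral_cmult)
  qed
  have left: "(\<integral>\<^sup>+t. ?d t * indicator {..- x} t \<partial>lborel) \<le> ?e * (\<integral>\<^sup>+s. ?d s * indicator {..<0} s \<partial>lborel)"
  proof -
    have "(\<integral>\<^sup>+t. ?d t * indicator {..- x} t \<partial>lborel) = (\<integral>\<^sup>+s. ?d (- x + s) * indicator {..- x} (- x + s) \<partial>lborel)"
      using nn_integral_real_affine[of "\<lambda>t. ?d t * indicator {..- x} t" 1 "- x"] by simp
    also have "\<dots> \<le> (\<integral>\<^sup>+s. ?e * (?d s * indicator {..<0} s) \<partial>lborel)"
    proof (rule nn_integral_mono_AE)
      show "AE s in lborel. ?d (- x + s) * indicator {..- x} (- x + s) \<le> ?e * (?d s * indicator {..<0} s)"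
        \<comment> \<open>The half-lines overlap in the origin, which is excluded on this side.\<close>
        using AE_lborel_singleton[of 0]
      proof eventually_elim
        case (elim s)
        then show ?case using shift[of "- s"] even[of "x - s"] even[of s]
          by (auto split: split_indicator)
      qed
    qed
    finally show ?thesis by (simp add: nn_integral_cmult)
  qed
  have "emeasure M {\<omega> \<in> space M. x \<le> \<bar>X \<omega>\<bar>} = emeasure M (X -` {t. x \<le> \<bar>t\<bar>} \<inter> space M)"
    by (intro arg_cong[where f="emeasure M"]) auto
  also have "\<dots> = (\<integral>\<^sup>+t. ?d t * indicator {t. x \<le> \<bar>t\<bar>} t \<partial>lborel)"
    by (rule distributed_emeasure[OF X]) simp
  also have "\<dots> \<le> (\<integral>\<^sup>+t. ?d t * indicator {x..} t + ?d t * indicator {..- x} t \<partial>lborel)"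
    by (intro nn_integral_mono) (auto split: split_indicator)
  also have "\<dots> = (\<integral>\<^sup>+t. ?d t * indicator {x..} t \<partial>lborel) + (\<integral>\<^sup>+t. ?d t * indicator {..- x} t \<partial>lborel)"
    by (rule nn_integral_add) auto
  also have "\<dots> \<le> ?e * (\<integral>\<^sup>+s. ?d s * indicator {0..} s \<partial>lborel) + ?e * (\<integral>\<^sup>+s. ?d s * indicator {..<0} s \<partial>lborel)"
    by (rule add_mono[OF right left])
  also have "\<dots> = ?e * (\<integral>\<^sup>+s. ?d s * indicator {0..} s + ?d s * indicator {..<0} s \<partial>lborel)"
    by (subst nn_integral_add) (auto simp: distrib_left)
  also have "(\<integral>\<^sup>+s. ?d s * indicator {0..} s + ?d s * indicator {..<0} s \<partial>lborel) = (\<integral>\<^sup>+s. ?d s \<partial>lborel)"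
    by (intro nn_integral_cong) (auto split: split_indicator)
  also have "\<dots> = 1"
    by (subst nn_integral_eq_integral) auto
  finally show ?thesis by (simp add: emeasure_eq_measure)
qed

lemma (in prob_space) prob_abs_eq_0:
  fixes x :: real
  assumes X: "distributed M lborel X (\<lambda>x. ennreal (d x))"
  shows "prob {\<omega> \<in> space M. \<bar>X \<omega>\<bar> = x} = 0"
proof -
  have "{t \<in> space borel. \<bar>t::real\<bar> = x} \<in> sets borel" by measurable
  then have borel: "{t::real. \<bar>t\<bar> = x} \<in> sets borel" by simp
  have "emeasure M {\<omega> \<in> space M. \<bar>X \<omega>\<bar> = x} = emeasure M (X -` {t. \<bar>t\<bar> = x} \<inter> space M)"
    by (intro arg_cong[where f="emeasure M"]) auto
  also have "\<dots> = (\<integral>\<^sup>+t. ennreal (d t) * indicator {t. \<bar>t\<bar> = x} t \<partial>lborel)"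
    by (rule distributed_emeasure[OF X]) (use borel in simp)
  also have "\<dots> = (\<integral>\<^sup>+t. 0 \<partial>(lborel :: real measure))"
  proof (rule nn_integral_cong_AE)
    show "AE t in lborel. ennreal (d t) * indicator {t. \<bar>t\<bar> = x} t = 0"
      using AE_lborel_singleton[of x] AE_lborel_singleton[of "- x"]
      by eventually_elim (auto split: split_indicator)
  qed
  finally show ?thesis by (simp add: emeasure_eq_measure)
qed

text \<open>The degenerate alternative in the Gaussian law is a constant, which has mean zero and hence
  second moment zero, whereas the second moment is the square of the \<open>L\<^sub>2\<close> norm.\<close>

lemma white_noise_std_normal:
  assumes noise: "white_noise P Z" and \<psi>: "\<psi> \<in> L2_space" and pos: "0 < L2norm \<psi>"
  shows "distributed P lborel (\<lambda>\<omega>. Z \<psi> \<omega> / L2norm \<psi>) std_normal_density"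
proof -
  interpret prob_space P using noise by (simp add: white_noise_def)
  have mean: "expectation (Z \<psi>) = 0" using noise \<psi> by (simp add: white_noise_def)
  have "expectation (\<lambda>\<omega>. Z \<psi> \<omega> * Z \<psi> \<omega>) = (LINT t|cube_measure. \<psi> t * \<psi> t)"
    using noise \<psi> unfolding white_noise_def by blast
  then have second: "expectation (\<lambda>\<omega>. (Z \<psi> \<omega>)\<^sup>2) = (L2norm \<psi>)\<^sup>2"
    by (simp add: power2_eq_square L2norm_def)
  have gp: "gaussian_process P L2_space Z" using noise by (simp add: white_noise_def)
  have "gaussian_rv P (\<lambda>\<omega>. \<Sum>j\<in>{\<psi>}. 1 * Z j \<omega>)"
    using gp[unfolded gaussian_process_def, rule_format, of "{\<psi>}" "\<lambda>_. 1"] \<psi> by simp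
  then have "gaussian_rv P (Z \<psi>)" by simp
  then have meas: "Z \<psi> \<in> borel_measurable P" and
    "(\<exists>\<mu> \<sigma>. \<sigma> > 0 \<and> distributed P lborel (Z \<psi>) (normal_density \<mu> \<sigma>)) \<or> (\<exists>\<mu>. AE \<omega> in P. Z \<psi> \<omega> = \<mu>)"
    unfolding gaussian_rv_def by auto
  then consider \<mu> \<sigma> where "\<sigma> > 0" "distributed P lborel (Z \<psi>) (normal_density \<mu> \<sigma>)"
    | \<mu> where "AE \<omega> in P. Z \<psi> \<omega> = \<mu>" by blast
  then show ?thesis
  proof cases
    case 1
    have "\<mu> = 0" using normal_distributed_expectation[OF 1] mean by simp
    moreover have "\<sigma>\<^sup>2 = (L2norm \<psi>)\<^sup>2" using normal_distributed_variance[OF 1] mean second by simp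
    then have "\<sigma> = L2norm \<psi>" using \<open>\<sigma> > 0\<close> pos by (simp add: power2_eq_iff_nonneg)
    ultimately show ?thesis using normal_standard_normal_convert[OF pos, of "Z \<psi>" 0] 1 by simp
  next
    case 2
    have "expectation (Z \<psi>) = expectation (\<lambda>_. \<mu>)" using 2 meas by (intro integral_cong_AE) auto
    then have "\<mu> = 0" using mean by (simp add: prob_space)
    then have "expectation (\<lambda>\<omega>. (Z \<psi> \<omega>)\<^sup>2) = expectation (\<lambda>_. 0)"
      using 2 meas by (intro integral_cong_AE) auto
    then show ?thesis using second pos by simp
  qed
qed

section \<open>The noise quantile\<close>

text \<open>The function \<open>\<kappa> \<mapsto> P (X \<ge> \<kappa>)\<close> is only left-continuous in general, so the infimum of the
  admissible levels need not be admissible. Without positive atoms it is also right-continuous at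
  positive levels, and a positive infimum is attained. The infimum is positive because \<open>P (X > 0)\<close> exceeds \<open>\<epsilon>\<close>.\<close>

lemma (in prob_space) Least_tail_quantile:
  fixes X :: "'a \<Rightarrow> real"
  assumes X: "X \<in> borel_measurable M"
    and no_atom: "\<And>x. 0 < x \<Longrightarrow> prob {\<omega> \<in> space M. X \<omega> = x} = 0"
    and pos: "\<epsilon> < prob {\<omega> \<in> space M. 0 < X \<omega>}"
    and b: "0 < b" "prob {\<omega> \<in> space M. b \<le> X \<omega>} \<le> \<epsilon>"
    and \<kappa>: "\<kappa> = (LEAST \<kappa>. 0 < \<kappa> \<and> prob {\<omega> \<in> space M. \<kappa> \<le> X \<omega>} \<le> \<epsilon>)"
  shows "0 < \<kappa>" "\<kappa> \<le> b" "prob {\<omega> \<in> space M. \<kappa> \<le> X \<omega>} \<le> \<epsilon>"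
proof -
  note X[measurable]
  define S where "S = {\<kappa>. 0 < \<kappa> \<and> prob {\<omega> \<in> space M. \<kappa> \<le> X \<omega>} \<le> \<epsilon>}"
  define s where "s = Inf S"
  have bS: "b \<in> S" using b by (simp add: S_def)
  have bdd: "bdd_below S" by (rule bdd_belowI[of _ 0]) (auto simp: S_def)
  have s0: "0 \<le> s" unfolding s_def using bS by (intro cInf_greatest) (auto simp: S_def)
  have lower: "s \<le> k" if "k \<in> S" for k unfolding s_def using that bdd by (rule cInf_lower)
  let ?A = "\<lambda>n::nat. {\<omega> \<in> space M. s + inverse (real (Suc n)) \<le> X \<omega>}"
  have A: "prob (?A n) \<le> \<epsilon>" for n
  proof -
    have "s < s + inverse (real (Suc n))" by simp
    then obtain k where k: "k \<in> S" "k < s + inverse (real (Suc n))"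
      using cInf_lessD[of S "s + inverse (real (Suc n))"] bS unfolding s_def by auto
    then have "prob (?A n) \<le> prob {\<omega> \<in> space M. k \<le> X \<omega>}"
      by (intro finite_measure_mono) auto
    then show ?thesis using k by (simp add: S_def)
  qed
  have UA: "(\<Union>n. ?A n) = {\<omega> \<in> space M. s < X \<omega>}"
  proof safe
    fix \<omega> n assume "s + inverse (real (Suc n)) \<le> X \<omega>"
    moreover have "0 < inverse (real (Suc n))" by simp
    ultimately show "s < X \<omega>" by linarith
  next
    fix \<omega> assume "\<omega> \<in> space M" "s < X \<omega>"
    then show "\<omega> \<in> (\<Union>n. ?A n)" using reals_Archimedean[of "X \<omega> - s"]
      by (auto simp: less_diff_eq add.commute intro: less_imp_le)
  qed
  have "(\<lambda>n. prob (?A n)) \<longlonglongrightarrow> prob (\<Union>n. ?A n)"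
  proof (rule finite_Lim_measure_incseq)
    show "incseq ?A"
    proof (rule incseq_SucI, safe)
      fix n \<omega> assume "s + inverse (real (Suc n)) \<le> X \<omega>"
      moreover have "inverse (real (Suc (Suc n))) \<le> inverse (real (Suc n))" by (simp add: field_simps)
      ultimately show "s + inverse (real (Suc (Suc n))) \<le> X \<omega>" by linarith
    qed
  qed auto
  from LIMSEQ_le_const2[OF this] A have gt: "prob {\<omega> \<in> space M. s < X \<omega>} \<le> \<epsilon>"
    unfolding UA by blast
  have "0 < s" using gt pos s0 by (cases "s = 0") auto
  have "prob {\<omega> \<in> space M. s \<le> X \<omega>} \<le> prob ({\<omega> \<in> space M. s < X \<omega>} \<union> {\<omega> \<in> space M. X \<omega> = s})"
    by (intro finite_measure_mono) auto
  also have "\<dots> \<le> prob {\<omega> \<in> space M. s < X \<omega>} + prob {\<omega> \<in> space M. X \<omega> = s}"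
    by (intro measure_Un_le) auto
  finally have "s \<in> S" using gt no_atom[OF \<open>0 < s\<close>] \<open>0 < s\<close> by (simp add: S_def)
  then have "\<kappa> = s" unfolding \<kappa> using lower by (intro Least_equality) (auto simp: S_def)
  then show "0 < \<kappa>" "\<kappa> \<le> b" "prob {\<omega> \<in> space M. \<kappa> \<le> X \<omega>} \<le> \<epsilon>"
    using \<open>s \<in> S\<close> lower[OF bS] by (auto simp: S_def)
qed

text \<open>Null probes contribute the ratio \<open>\<bar>Z \<psi>\<bar> / 0 = 0\<close> and so influence no event concerning positive
  levels; a single probe \<open>\<phi>\<close> that is not null makes the maximum positive almost surely. The
  level \<open>b = sqrt (2 ln (card \<Psi> / \<epsilon>))\<close> is the one at which each probe has tail \<open>\<epsilon> / card \<Psi>\<close>.\<close>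

lemma white_noise_quantile:
  fixes Z :: "(real^'d \<Rightarrow> real) \<Rightarrow> 'w \<Rightarrow> real"
  assumes noise: "white_noise P Z" and fin: "finite \<Psi>" and sub: "\<Psi> \<subseteq> L2_space"
    and \<phi>: "\<phi> \<in> \<Psi>" "0 < L2norm \<phi>" and \<epsilon>: "0 < \<epsilon>" "\<epsilon> < 1"
    and \<kappa>: "\<kappa> = noise_quantile P Z \<Psi> \<epsilon>"
    and R: "R = (\<lambda>\<omega>. Max ((\<lambda>\<psi>. \<bar>Z \<psi> \<omega>\<bar> / L2norm \<psi>) ` \<Psi>))"
  shows "R \<in> borel_measurable P" "0 < \<kappa>" "\<kappa> \<le> sqrt (2 * ln (card \<Psi> / \<epsilon>))"
    and "measure P {\<omega> \<in> space P. \<kappa> \<le> R \<omega>} \<le> \<epsilon>"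
proof -
  interpret prob_space P using noise by (simp add: white_noise_def)
  let ?X = "\<lambda>\<psi> \<omega>. Z \<psi> \<omega> / L2norm \<psi>"
  have R: "R = (\<lambda>\<omega>. Max ((\<lambda>\<psi>. \<bar>?X \<psi> \<omega>\<bar>) ` \<Psi>))"
    by (simp add: R L2norm_nonneg)
  have normal: "distributed P lborel (?X \<psi>) std_normal_density" if "\<psi> \<in> \<Psi>" "0 < L2norm \<psi>" for \<psi>
    using white_noise_std_normal[OF noise] sub that by blast
  have null: "?X \<psi> \<omega> = 0" if "\<not> 0 < L2norm \<psi>" for \<psi> \<omega>
    using that L2norm_nonneg[of \<psi>] by simp
  have meas[measurable]: "?X \<psi> \<in> borel_measurable P" if "\<psi> \<in> \<Psi>" for \<psi>
  proof (cases "0 < L2norm \<psi>")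
    case True
    then show ?thesis using distributed_measurable[OF normal[OF that]] by simp
  next
    case False
    show ?thesis by (simp only: null[OF False]) simp
  qed
  show Rm[measurable]: "R \<in> borel_measurable P"
    unfolding R using fin by (intro borel_measurable_Max borel_measurable_abs meas)
  have ne: "(\<lambda>\<psi>. \<bar>?X \<psi> \<omega>\<bar>) ` \<Psi> \<noteq> {}" for \<omega> using \<phi> by auto
  \<comment> \<open>A maximum over a finite set is one of its members, so any property of it passes to a union.\<close>
  have union: "prob {\<omega> \<in> space P. Q (R \<omega>)} \<le> (\<Sum>\<psi>\<in>\<Psi>. c)"
    if Q: "Measurable.pred borel Q" and c: "\<And>\<psi>. \<psi> \<in> \<Psi> \<Longrightarrow> prob {\<omega> \<in> space P. Q \<bar>?X \<psi> \<omega>\<bar>} \<le> c"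
    for Q :: "real \<Rightarrow> bool" and c
  proof -
    have ev: "{\<omega> \<in> space P. Q \<bar>?X \<psi> \<omega>\<bar>} \<in> events" if "\<psi> \<in> \<Psi>" for \<psi>
      using Q meas[OF that] by measurable
    have "prob {\<omega> \<in> space P. Q (R \<omega>)} \<le> prob (\<Union>\<psi>\<in>\<Psi>. {\<omega> \<in> space P. Q \<bar>?X \<psi> \<omega>\<bar>})"
    proof (rule finite_measure_mono)
      show "{\<omega> \<in> space P. Q (R \<omega>)} \<subseteq> (\<Union>\<psi>\<in>\<Psi>. {\<omega> \<in> space P. Q \<bar>?X \<psi> \<omega>\<bar>})"
      proof
        fix \<omega> assume "\<omega> \<in> {\<omega> \<in> space P. Q (R \<omega>)}"
        moreover have "R \<omega> \<in> (\<lambda>\<psi>. \<bar>?X \<psi> \<omega>\<bar>) ` \<Psi>"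
          unfolding R by (intro Max_in finite_imageI fin ne)
        ultimately show "\<omega> \<in> (\<Union>\<psi>\<in>\<Psi>. {\<omega> \<in> space P. Q \<bar>?X \<psi> \<omega>\<bar>})" by auto
      qed
      show "(\<Union>\<psi>\<in>\<Psi>. {\<omega> \<in> space P. Q \<bar>?X \<psi> \<omega>\<bar>}) \<in> events"
        using ev fin by (intro sets.finite_UN) auto
    qed
    also have "\<dots> \<le> (\<Sum>\<psi>\<in>\<Psi>. prob {\<omega> \<in> space P. Q \<bar>?X \<psi> \<omega>\<bar>})"
      using ev fin by (intro measure_UNION_le) auto
    also have "\<dots> \<le> (\<Sum>\<psi>\<in>\<Psi>. c)" by (intro sum_mono c)
    finally show ?thesis .
  qed
  have card: "1 \<le> real (card \<Psi>)"
    using fin \<phi> by (metis One_nat_def Suc_leI card_gt_0_iff empty_iff of_nat_1 of_nat_mono)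
  define b where "b = sqrt (2 * ln (card \<Psi> / \<epsilon>))"
  have "1 < card \<Psi> / \<epsilon>" using card \<epsilon> by (simp add: field_simps)
  then have lnpos: "0 < ln (card \<Psi> / \<epsilon>)" by simp
  then have b: "0 < b" by (simp add: b_def)
  have exp_b: "exp (- b\<^sup>2 / 2) = \<epsilon> / card \<Psi>"
  proof -
    have "- b\<^sup>2 / 2 = - ln (card \<Psi> / \<epsilon>)" using lnpos by (simp add: b_def)
    also have "exp \<dots> = inverse (card \<Psi> / \<epsilon>)"
      using card \<epsilon> by (subst exp_minus) (simp add: exp_ln)
    finally show ?thesis by simp
  qed
  have tail: "prob {\<omega> \<in> space P. b \<le> R \<omega>} \<le> \<epsilon>"
  proof -
    have "prob {\<omega> \<in> space P. b \<le> \<bar>?X \<psi> \<omega>\<bar>} \<le> \<epsilon> / card \<Psi>" if "\<psi> \<in> \<Psi>" for \<psi>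
    proof (cases "0 < L2norm \<psi>")
      case True
      then show ?thesis using std_normal_tail[OF normal[OF that], of b] b exp_b by simp
    next
      case False
      have empty: "{\<omega> \<in> space P. b \<le> \<bar>?X \<psi> \<omega>\<bar>} = {}" using b by (simp only: null[OF False]) simp
      show ?thesis unfolding empty using \<epsilon> by simp
    qed
    from union[OF _ this] have "prob {\<omega> \<in> space P. b \<le> R \<omega>} \<le> (\<Sum>\<psi>\<in>\<Psi>. \<epsilon> / card \<Psi>)"
      by simp
    also have "\<dots> = \<epsilon>" using card by simp
    finally show ?thesis .
  qed
  have no_atom: "prob {\<omega> \<in> space P. R \<omega> = x} = 0" if "0 < x" for x
  proof -
    have "prob {\<omega> \<in> space P. \<bar>?X \<psi> \<omega>\<bar> = x} \<le> 0" if "\<psi> \<in> \<Psi>" for \<psi>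
    proof (cases "0 < L2norm \<psi>")
      case True
      then show ?thesis using prob_abs_eq_0[OF normal[OF that], of x] by simp
    next
      case False
      have empty: "{\<omega> \<in> space P. \<bar>?X \<psi> \<omega>\<bar> = x} = {}" using \<open>0 < x\<close> by (simp only: null[OF False]) simp
      show ?thesis unfolding empty by simp
    qed
    from union[OF _ this] show ?thesis by (simp add: measure_le_0_iff)
  qed
  have pos: "\<epsilon> < prob {\<omega> \<in> space P. 0 < R \<omega>}"
  proof -
    have "{\<omega> \<in> space P. \<not> 0 < R \<omega>} \<subseteq> {\<omega> \<in> space P. \<bar>?X \<phi> \<omega>\<bar> = 0}"
    proof safe
      fix \<omega> assume "\<not> 0 < R \<omega>"
      moreover have "\<bar>?X \<phi> \<omega>\<bar> \<le> R \<omega>"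
        unfolding R by (rule Max_ge[OF finite_imageI[OF fin] imageI[OF \<phi>(1)]])
      ultimately show "\<bar>?X \<phi> \<omega>\<bar> = 0" by linarith
    qed
    then have "prob {\<omega> \<in> space P. \<not> 0 < R \<omega>} \<le> prob {\<omega> \<in> space P. \<bar>?X \<phi> \<omega>\<bar> = 0}"
      by (intro finite_measure_mono borel_measurable_eq borel_measurable_abs borel_measurable_const meas \<phi>)
    also have "\<dots> = 0" by (rule prob_abs_eq_0[OF normal[OF \<phi>]])
    finally have "prob {\<omega> \<in> space P. 0 < R \<omega>} = 1"
      by (subst (asm) prob_neg) (auto simp: measure_le_0_iff intro: antisym)
    then show ?thesis using \<epsilon> by simp
  qed
  have \<kappa>': "\<kappa> = (LEAST \<kappa>. 0 < \<kappa> \<and> prob {\<omega> \<in> space P. \<kappa> \<le> R \<omega>} \<le> \<epsilon>)"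
    unfolding \<kappa> noise_quantile_def R by (simp add: L2norm_nonneg)
  note q = Least_tail_quantile[OF Rm no_atom pos b tail \<kappa>']
  show "0 < \<kappa>" "\<kappa> \<le> sqrt (2 * ln (card \<Psi> / \<epsilon>))" "prob {\<omega> \<in> space P. \<kappa> \<le> R \<omega>} \<le> \<epsilon>"
    using q by (auto simp: b_def)
qed

section \<open>Comparing the selected index with the oracle\<close>

lemma Delta_eq:
  assumes "ess_bounded f" "ess_bounded h" "ess_bounded \<psi>"
  shows "Delta Z \<epsilon> f h \<psi> \<omega> = (LINT t|cube_measure. \<psi> t * (f t - h t)) + \<epsilon> * Z \<psi> \<omega>"
  using assms by (simp add: Delta_def observation_def right_diff_distrib integrable_ess_bounded ess_bounded_mult)

lemma probe_set_subset_image: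
  "probe_set I fs \<gamma> \<subseteq> (\<lambda>p. probe \<gamma> (\<lambda>t. fs (fst p) t - fs (snd p) t)) ` (I \<times> I)"
proof
  fix \<psi> assume "\<psi> \<in> probe_set I fs \<gamma>"
  then obtain i j where "i \<in> I" "j \<in> I" and \<psi>: "\<psi> = probe \<gamma> (\<lambda>t. fs i t - fs j t)"
    unfolding probe_set_def by blast
  then show "\<psi> \<in> (\<lambda>p. probe \<gamma> (\<lambda>t. fs (fst p) t - fs (snd p) t)) ` (I \<times> I)"
    by (intro image_eqI[where x="(i, j)"]) auto
qed

lemma finite_probe_set: "finite I \<Longrightarrow> finite (probe_set I fs \<gamma>)"
  by (rule finite_subset[OF probe_set_subset_image]) simp

lemma card_probe_set_le:
  assumes "finite I"
  shows "card (probe_set I fs \<gamma>) \<le> (card I)\<^sup>2"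
proof -
  have "card (probe_set I fs \<gamma>) \<le> card (I \<times> I)"
    by (rule surj_card_le[OF _ probe_set_subset_image]) (use assms in simp)
  then show ?thesis by (simp add: power2_eq_square card_cartesian_product)
qed

text \<open>The residual of \<open>h\<close> on a probe is \<open>\<integral> \<psi> (f - h)\<close> plus noise; the penalty \<open>\<epsilon> \<kappa> \<parallel>\<psi>\<parallel>\<^sub>2\<close>
  absorbs the noise and the division by \<open>\<parallel>\<psi>\<parallel>\<^sub>1\<close> normalises the rest.\<close>

lemma Mhat_le_Linf:
  assumes f: "ess_bounded f" and h: "ess_bounded h"
    and \<Psi>: "finite \<Psi>" "\<Psi> \<noteq> {}" "\<And>\<psi>. \<psi> \<in> \<Psi> \<Longrightarrow> ess_bounded \<psi>" and \<epsilon>: "0 \<le> \<epsilon>"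
    and noise: "\<And>\<psi>. \<psi> \<in> \<Psi> \<Longrightarrow> 0 < L2norm \<psi> \<Longrightarrow> \<bar>Z \<psi> \<omega>\<bar> \<le> \<kappa> * L2norm \<psi>"
  shows "Mhat Z \<epsilon> f \<Psi> \<kappa> h \<omega> \<le> Linf (\<lambda>t. f t - h t)"
  unfolding Mhat_def
proof (subst Max_le_iff, use \<Psi> in simp, use \<Psi> in simp, safe)
  fix \<psi> assume \<psi>: "\<psi> \<in> \<Psi>"
  let ?B = "Linf (\<lambda>t. f t - h t)"
  show "1 / L1norm \<psi> * (\<bar>Delta Z \<epsilon> f h \<psi> \<omega>\<bar> - \<epsilon> * \<kappa> * L2norm \<psi>) \<le> ?B"
  proof (cases "L1norm \<psi> = 0")
    case True
    \<comment> \<open>Division by zero gives zero: a null probe contributes nothing to the statistic.\<close>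
    then show ?thesis by (simp add: Linf_nonneg)
  next
    case False
    then have pos: "0 < L1norm \<psi>" using L1norm_nonneg[of \<psi>] by simp
    then have "0 < L2norm \<psi>" using L1norm_le_L2norm[OF \<Psi>(3)[OF \<psi>]] by simp
    from mult_left_mono[OF noise[OF \<psi> this] \<epsilon>]
    have "\<bar>\<epsilon> * Z \<psi> \<omega>\<bar> \<le> \<epsilon> * \<kappa> * L2norm \<psi>" using \<epsilon> by (simp add: abs_mult mult.assoc)
    moreover have "\<bar>LINT t|cube_measure. \<psi> t * (f t - h t)\<bar> \<le> L1norm \<psi> * ?B"
      by (intro abs_integral_mult_le ess_bounded_intros \<Psi>(3) \<psi> f h)
    ultimately have "\<bar>Delta Z \<epsilon> f h \<psi> \<omega>\<bar> - \<epsilon> * \<kappa> * L2norm \<psi> \<le> L1norm \<psi> * ?B"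
      unfolding Delta_eq[OF f h \<Psi>(3)[OF \<psi>]] by linarith
    then show ?thesis using pos by (simp add: divide_le_eq mult.commute)
  qed
qed

lemma abs_Delta_le_Mhat:
  assumes "finite \<Psi>" "\<psi> \<in> \<Psi>" "0 < L1norm \<psi>"
  shows "\<bar>Delta Z \<epsilon> f h \<psi> \<omega>\<bar> \<le> L1norm \<psi> * Mhat Z \<epsilon> f \<Psi> \<kappa> h \<omega> + \<epsilon> * \<kappa> * L2norm \<psi>"
proof -
  have "1 / L1norm \<psi> * (\<bar>Delta Z \<epsilon> f h \<psi> \<omega>\<bar> - \<epsilon> * \<kappa> * L2norm \<psi>) \<le> Mhat Z \<epsilon> f \<Psi> \<kappa> h \<omega>"
    unfolding Mhat_def using assms by (intro Max_ge) auto
  then show ?thesis using assms(3) by (simp add: divide_le_eq mult.commute)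
qed

text \<open>The signal \<open>f\<close> and the noise cancel in the difference of the residuals of \<open>f\<^sub>i\<close> and \<open>f\<^sub>s\<close> on the
  probe of \<open>f\<^sub>s - f\<^sub>i\<close>, which leaves the integral from which the supremum norm is read off. Both
  residuals are controlled by the statistic of the oracle, since selection makes the other one
  smaller.\<close>

lemma selected_close_to_oracle:
  fixes fs :: "nat \<Rightarrow> real^'d \<Rightarrow> real"
  assumes I: "finite I" "i \<in> I" "s \<in> I" "i \<noteq> s"
    and f: "ess_bounded f" and fs: "\<And>j. j \<in> I \<Longrightarrow> ess_bounded (fs j)"
    and \<Psi>: "\<Psi> = probe_set I fs \<gamma>" and \<gamma>: "0 < \<gamma>" and \<epsilon>: "0 \<le> \<epsilon>" and \<kappa>: "0 \<le> \<kappa>"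
    and noise: "\<And>\<psi>. \<psi> \<in> \<Psi> \<Longrightarrow> 0 < L2norm \<psi> \<Longrightarrow> \<bar>Z \<psi> \<omega>\<bar> \<le> \<kappa> * L2norm \<psi>"
    and sel: "Mhat Z \<epsilon> f \<Psi> \<kappa> (fs i) \<omega> \<le> Mhat Z \<epsilon> f \<Psi> \<kappa> (fs s) \<omega>"
    and S: "S = trunc \<gamma> (\<lambda>t. fs s t - fs i t)"
  shows "Linf (\<lambda>t. fs s t - fs i t)
    \<le> 2 * Linf (\<lambda>t. f t - fs s t) + \<gamma> + 2 * \<epsilon> * \<kappa> * (L2norm S / L1norm S)"
proof -
  define g where "g = (\<lambda>t. fs s t - fs i t)"
  define \<psi> where "\<psi> = probe \<gamma> g"
  let ?B = "Linf (\<lambda>t. f t - fs s t)"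
  have S: "S = trunc \<gamma> g" by (simp add: S g_def)
  have g: "ess_bounded g" unfolding g_def by (intro ess_bounded_intros fs I)
  have fin: "finite \<Psi>" using I by (simp add: \<Psi> finite_probe_set)
  have \<psi>: "\<psi> \<in> \<Psi>" using I by (auto simp: \<Psi> probe_set_def \<psi>_def g_def)
  have bdd: "ess_bounded \<phi>" if "\<phi> \<in> \<Psi>" for \<phi>
    using that fs by (auto simp: \<Psi> probe_set_def intro!: ess_bounded_probe ess_bounded_diff(1))
  have nonneg: "0 \<le> 2 * \<epsilon> * \<kappa> * (L2norm S / L1norm S)"
    using \<epsilon> \<kappa> by (simp add: L1norm_nonneg L2norm_nonneg)
  have "Linf g \<le> 2 * ?B + \<gamma> + 2 * \<epsilon> * \<kappa> * (L2norm S / L1norm S)"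
  proof (cases "L1norm \<psi> = 0")
    case True
    then have "Linf g = 0" unfolding \<psi>_def by (rule Linf_eq_0_if_probe_null[OF g \<gamma>])
    then show ?thesis using nonneg \<gamma> Linf_nonneg[of "\<lambda>t. f t - fs s t"] by linarith
  next
    case False
    then have pos: "0 < L1norm \<psi>" using L1norm_nonneg[of \<psi>] by simp
    have Ms: "Mhat Z \<epsilon> f \<Psi> \<kappa> (fs s) \<omega> \<le> ?B"
      using \<psi> by (intro Mhat_le_Linf f fs I fin bdd \<epsilon> noise) auto
    have D: "\<bar>Delta Z \<epsilon> f (fs j) \<psi> \<omega>\<bar> \<le> L1norm \<psi> * ?B + \<epsilon> * \<kappa> * L2norm \<psi>"
      if "Mhat Z \<epsilon> f \<Psi> \<kappa> (fs j) \<omega> \<le> ?B" for j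
      using abs_Delta_le_Mhat[OF fin \<psi> pos, of Z \<epsilon> f "fs j" \<omega> \<kappa>] mult_left_mono[OF that, of "L1norm \<psi>"] pos
      by linarith
    have "Linf g - \<gamma> \<le> (LINT t|cube_measure. \<psi> t * g t)"
      unfolding \<psi>_def by (rule integral_probe_ge[OF g \<gamma>])
    also have "\<dots> = Delta Z \<epsilon> f (fs i) \<psi> \<omega> - Delta Z \<epsilon> f (fs s) \<psi> \<omega>"
      using I fs bdd[OF \<psi>] by (simp add: Delta_def g_def right_diff_distrib integrable_ess_bounded ess_bounded_mult)
    finally have "Linf g - \<gamma> \<le> 2 * (L1norm \<psi> * ?B + \<epsilon> * \<kappa> * L2norm \<psi>)"
      using D[OF Ms] D[OF order_trans[OF sel Ms]] unfolding mult_2 by linarith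
    moreover have "L1norm \<psi> * ?B \<le> ?B"
      unfolding \<psi>_def using mult_right_mono[OF L1norm_probe_le_1[OF g \<gamma>] Linf_nonneg] by simp
    moreover have "\<epsilon> * \<kappa> * L2norm \<psi> \<le> \<epsilon> * \<kappa> * (L2norm S / L1norm S)"
      unfolding S \<psi>_def using \<epsilon> \<kappa> by (intro mult_left_mono L2norm_probe_le g) simp
    ultimately show ?thesis unfolding mult_2 distrib_right by linarith
  qed
  then show ?thesis by (simp add: g_def)
qed

text \<open>This bound lets the bias \<open>\<gamma>\<^sub>0\<close> of the probes be counted as part of the noise term.\<close>

lemma Q4_ge_1:
  assumes I: "finite I" "s \<in> I" "2 \<le> card I" and fs: "\<And>j. j \<in> I \<Longrightarrow> ess_bounded (fs j)" and \<gamma>: "0 < \<gamma>"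
  shows "1 \<le> Q4 I fs s \<gamma>"
proof -
  have "I - {s} \<noteq> {}"
  proof
    assume "I - {s} = {}"
    then have "I = {s}" using I by auto
    then show False using I by simp
  qed
  then obtain i where i: "i \<in> I" "i \<noteq> s" by blast
  let ?S = "trunc \<gamma> (\<lambda>t. fs s t - fs i t)"
  have g: "ess_bounded (\<lambda>t. fs s t - fs i t)" using fs I i by (intro ess_bounded_intros) auto
  have "1 \<le> L2norm ?S / L1norm ?S"
    using L1norm_le_L2norm[OF ess_bounded_trunc[OF g]] L1norm_trunc_pos[OF g \<gamma>] by simp
  also have "\<dots> \<le> Q4 I fs s \<gamma>" unfolding Q4_def using I i by (intro Max_ge) auto
  finally show ?thesis .
qed

section \<open>The risk bound\<close>

theorem corollary3:
  fixes P :: "'w measure"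
    and Z :: "(real^'d \<Rightarrow> real) \<Rightarrow> 'w \<Rightarrow> real"
    and f :: "real^'d \<Rightarrow> real"
    and fs :: "nat \<Rightarrow> real^'d \<Rightarrow> real"
    and N istar :: nat
    and ihat :: "'w \<Rightarrow> nat"
    and \<epsilon> \<gamma>\<^sub>0 \<kappa> L :: real
    and \<Psi> :: "(real^'d \<Rightarrow> real) set"
  assumes noise: "white_noise P Z"
    and eps: "0 < \<epsilon>" "\<epsilon> < 1"
    and N: "N \<ge> 2"
    and f_meas: "f \<in> borel_measurable cube_measure"
    and fs_meas: "\<And>i. i \<in> {1..N} \<Longrightarrow> fs i \<in> borel_measurable cube_measure"
    and distinct: "inj_on (\<lambda>i. restrict (fs i) unit_cube) {1..N}"
    and L: "Max (insert (Linf_ext f) ((\<lambda>i. Linf_ext (fs i)) ` {1..N})) = ereal L"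
    and \<gamma>\<^sub>0: "\<gamma>\<^sub>0 = \<epsilon> * sqrt (ln (real N))" "\<gamma>\<^sub>0 < L"
    and \<Psi>: "\<Psi> = probe_set {1..N} fs \<gamma>\<^sub>0"
    and \<kappa>: "\<kappa> = noise_quantile P Z \<Psi> \<epsilon>"
    and ihat_meas: "ihat \<in> measurable P (count_space UNIV)"
    and ihat: "\<And>\<omega>. \<omega> \<in> space P \<Longrightarrow>
       is_arg_min (\<lambda>i. Mhat Z \<epsilon> f \<Psi> \<kappa> (fs i) \<omega>) (\<lambda>i. i \<in> {1..N}) (ihat \<omega>)"
    and istar: "is_arg_min (\<lambda>i. Linf (\<lambda>t. f t - fs i t)) (\<lambda>i. i \<in> {1..N}) istar"
  shows "Linf_risk P (\<lambda>\<omega>. fs (ihat \<omega>)) f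
     \<le> 3 * Min ((\<lambda>i. Linf (\<lambda>t. fs i t - f t)) ` {1..N})
       + 3 * Q4 {1..N} fs istar \<gamma>\<^sub>0 * \<epsilon> * sqrt (2 * ln ((real N)\<^sup>2 / \<epsilon>))
       + 2 * L * \<epsilon>"
proof -
  interpret prob_space P using noise by (simp add: white_noise_def)
  define I where "I = {1..N}"
  define B where "B = Linf (\<lambda>t. f t - fs istar t)"
  define Q where "Q = Q4 I fs istar \<gamma>\<^sub>0"
  define K where "K = sqrt (2 * ln ((real N)\<^sup>2 / \<epsilon>))"
  define T where "T = 3 * B + 3 * Q * \<epsilon> * K"
  define loss where "loss = (\<lambda>\<omega>. Linf (\<lambda>t. fs (ihat \<omega>) t - f t))"
  have I: "finite I" "2 \<le> card I" "istar \<in> I"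
    using N istar by (auto simp: I_def is_arg_min_def)
  have ihat_I: "ihat \<omega> \<in> I" if "\<omega> \<in> space P" for \<omega>
    using ihat[OF that] by (simp add: is_arg_min_def I_def)

  have Lf: "Linf_ext f \<le> ereal L"
    unfolding L[symmetric] by (rule Max_ge) auto
  have Lfs: "Linf_ext (fs i) \<le> ereal L" if "i \<in> I" for i
    unfolding L[symmetric] by (rule Max_ge) (use that in \<open>auto simp: I_def\<close>)
  have f: "ess_bounded f"
    using le_less_trans[OF Lf, of \<infinity>] f_meas by (simp add: ess_bounded_iff_Linf_ext)
  have fs: "ess_bounded (fs i)" if "i \<in> I" for i
    using le_less_trans[OF Lfs[OF that], of \<infinity>] fs_meas that by (simp add: ess_bounded_iff_Linf_ext I_def)
  have loss_le: "Linf (\<lambda>t. fs i t - f t) \<le> 2 * L" if "i \<in> I" for i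
  proof -
    have "Linf (fs i) \<le> L" "Linf f \<le> L"
      using Lf Lfs[OF that] by (simp_all flip: ereal_Linf[OF f] ereal_Linf[OF fs[OF that]])
    then show ?thesis using Linf_diff_le[OF fs[OF that] f] by linarith
  qed

  have lnN: "0 < ln (real N)" using N by simp
  then have \<gamma>: "0 < \<gamma>\<^sub>0" using eps \<gamma>\<^sub>0 by simp
  have Q: "1 \<le> Q" unfolding Q_def using I by (intro Q4_ge_1 fs \<gamma>) auto
  have ln_eq: "ln ((real N)\<^sup>2 / \<epsilon>) = 2 * ln (real N) - ln \<epsilon>"
    using N eps by (simp add: ln_div ln_realpow)
  have ln_eps: "ln \<epsilon> < 0" using eps by simp
  have K: "\<gamma>\<^sub>0 \<le> \<epsilon> * K"
    unfolding \<gamma>\<^sub>0 K_def ln_eq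
  proof (intro mult_left_mono real_sqrt_le_mono)
    show "ln (real N) \<le> 2 * (2 * ln (real N) - ln \<epsilon>)" using lnN ln_eps by argo
  qed (use eps in simp)
  have K0: "0 \<le> K" unfolding K_def ln_eq using lnN ln_eps by simp
  have B0: "0 \<le> B" by (simp add: B_def Linf_nonneg)
  have noise_term: "0 \<le> Q * \<epsilon> * K" using Q eps K0 by simp
  have T0: "0 \<le> T" using B0 noise_term by (simp add: T_def mult.assoc)

  have fin: "finite \<Psi>" using I by (simp add: \<Psi> finite_probe_set flip: I_def)
  have bdd: "ess_bounded \<psi>" if "\<psi> \<in> \<Psi>" for \<psi>
    using that fs by (auto simp: \<Psi> probe_set_def I_def intro!: ess_bounded_probe ess_bounded_diff(1))
  have loss_triangle: "Linf (\<lambda>t. fs i t - f t) \<le> Linf (\<lambda>t. fs istar t - fs i t) + B" if "i \<in> I" for i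
    using Linf_diff_triangle[OF fs[OF that] fs[OF I(3)] f]
    unfolding B_def Linf_diff_commute[of f] Linf_diff_commute[of "fs istar" "fs i"] .

  \<comment> \<open>\<open>A\<close> is where the noise exceeds its quantile; it is empty if all probes are null.\<close>
  obtain A where A: "A \<in> events" "prob A \<le> \<epsilon>" and good: "\<And>\<omega>. \<omega> \<in> space P - A \<Longrightarrow> loss \<omega> \<le> T"
  proof (cases "\<exists>\<phi>\<in>\<Psi>. 0 < L2norm \<phi>")
    case True
    then obtain \<phi> where \<phi>: "\<phi> \<in> \<Psi>" "0 < L2norm \<phi>" by blast
    define R where "R = (\<lambda>\<omega>. Max ((\<lambda>\<psi>. \<bar>Z \<psi> \<omega>\<bar> / L2norm \<psi>) ` \<Psi>))"
    have sub: "\<Psi> \<subseteq> L2_space" using bdd ess_bounded_L2_space by blast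
    note quantile = white_noise_quantile[OF noise fin sub \<phi> eps \<kappa> R_def]
    note [measurable] = quantile(1)
    have "\<kappa> \<le> K"
    proof -
      have "0 < card \<Psi>" using fin \<phi> by (auto simp: card_gt_0_iff)
      moreover have "card \<Psi> \<le> N\<^sup>2"
        using card_probe_set_le[of "{1..N}" fs \<gamma>\<^sub>0] by (simp add: \<Psi>)
      then have "real (card \<Psi>) \<le> (real N)\<^sup>2" by (metis of_nat_mono of_nat_power)
      ultimately have "sqrt (2 * ln (card \<Psi> / \<epsilon>)) \<le> K"
        unfolding K_def using eps N
        by (intro real_sqrt_le_mono mult_left_mono ln_mono divide_right_mono) auto
      with quantile(3) show ?thesis by linarith
    qed
    show thesis
    proof (rule that)
      show "{\<omega> \<in> space P. \<kappa> \<le> R \<omega>} \<in> events" by measurable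
      show "prob {\<omega> \<in> space P. \<kappa> \<le> R \<omega>} \<le> \<epsilon>" by (rule quantile(4))
      fix \<omega> assume \<omega>: "\<omega> \<in> space P - {\<omega> \<in> space P. \<kappa> \<le> R \<omega>}"
      then have i: "ihat \<omega> \<in> I" using ihat_I by blast
      show "loss \<omega> \<le> T"
      proof (cases "ihat \<omega> = istar")
        case True
        then have "loss \<omega> = B" by (simp add: loss_def B_def Linf_diff_commute[of f])
        then show ?thesis using B0 noise_term by (simp add: T_def)
      next
        case False
        define S where "S = trunc \<gamma>\<^sub>0 (\<lambda>t. fs istar t - fs (ihat \<omega>) t)"
        have small: "\<bar>Z \<psi> \<omega>\<bar> \<le> \<kappa> * L2norm \<psi>" if "\<psi> \<in> \<Psi>" "0 < L2norm \<psi>" for \<psi>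
        proof -
          have "\<bar>Z \<psi> \<omega>\<bar> / L2norm \<psi> \<le> R \<omega>"
            unfolding R_def by (rule Max_ge[OF finite_imageI[OF fin] imageI[OF that(1)]])
          also have "\<dots> \<le> \<kappa>" using \<omega> by auto
          finally show ?thesis using that(2) by (simp add: divide_le_eq)
        qed
        have sel: "Mhat Z \<epsilon> f \<Psi> \<kappa> (fs (ihat \<omega>)) \<omega> \<le> Mhat Z \<epsilon> f \<Psi> \<kappa> (fs istar) \<omega>"
          using ihat[of \<omega>] \<omega> I(3) by (auto simp: is_arg_min_def I_def not_less)
        have "Linf (\<lambda>t. fs istar t - fs (ihat \<omega>) t) \<le> 2 * B + \<gamma>\<^sub>0 + 2 * \<epsilon> * \<kappa> * (L2norm S / L1norm S)"
          unfolding B_def using eps quantile(2)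
          by (intro selected_close_to_oracle[OF I(1) i I(3) False f fs _ \<gamma> _ _ small sel S_def])
            (auto simp: \<Psi> I_def)
        moreover have "\<kappa> * (L2norm S / L1norm S) \<le> K * Q"
        proof (rule mult_mono)
          show "L2norm S / L1norm S \<le> Q"
            unfolding Q_def Q4_def S_def using I i False by (intro Max_ge) auto
        qed (use \<open>\<kappa> \<le> K\<close> K0 in \<open>simp_all add: L1norm_nonneg L2norm_nonneg\<close>)
        from mult_left_mono[OF this, of "2 * \<epsilon>"]
        have "2 * \<epsilon> * \<kappa> * (L2norm S / L1norm S) \<le> 2 * (Q * \<epsilon> * K)"
          using eps by (simp only: mult_ac)
        moreover have "\<gamma>\<^sub>0 \<le> Q * \<epsilon> * K"
        proof -
          have "1 * (\<epsilon> * K) \<le> Q * (\<epsilon> * K)" using Q eps K0 by (intro mult_right_mono) auto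
          then show ?thesis using K by (simp only: mult.assoc mult_1_left)
        qed
        ultimately show ?thesis
          using loss_triangle[OF i] unfolding T_def loss_def by simp
      qed
    qed
  next
    case False
    \<comment> \<open>Here \<open>\<kappa>\<close> is unspecified, since every positive level is admissible and none is least. All
      the \<open>f\<^sub>i\<close> agree almost everywhere, so the value of \<open>\<kappa>\<close> does not influence the loss.\<close>
    show thesis
    proof (rule that[of "{}"])
      fix \<omega> assume "\<omega> \<in> space P - {}"
      then have i: "ihat \<omega> \<in> I" using ihat_I by simp
      have "loss \<omega> \<le> B"
      proof (cases "ihat \<omega> = istar")
        case True
        then show ?thesis by (simp add: loss_def B_def Linf_diff_commute[of f])
      next
        case neq: False
        let ?g = "\<lambda>t. fs istar t - fs (ihat \<omega>) t"
        have "probe \<gamma>\<^sub>0 ?g \<in> \<Psi>" using i I(3) neq by (auto simp: \<Psi> probe_set_def I_def)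
        then have "L1norm (probe \<gamma>\<^sub>0 ?g) \<le> 0"
          using False L1norm_le_L2norm[OF bdd] by force
        then have "L1norm (probe \<gamma>\<^sub>0 ?g) = 0" by (simp add: L1norm_nonneg antisym)
        then have "Linf ?g = 0" by (intro Linf_eq_0_if_probe_null[OF _ \<gamma>] ess_bounded_diff(1) fs i I(3))
        then show ?thesis using loss_triangle[OF i] by (simp add: loss_def)
      qed
      then show "loss \<omega> \<le> T" using B0 noise_term by (simp add: T_def)
    qed (use eps in auto)
  qed

  have loss_meas: "loss \<in> borel_measurable P"
    unfolding loss_def by (rule measurable_compose[OF ihat_meas]) simp
  have L0: "0 \<le> L" using \<gamma> \<gamma>\<^sub>0 by simp
  have int_loss: "integrable P loss"
  proof (rule integrable_const_bound)
    show "AE \<omega> in P. norm (loss \<omega>) \<le> 2 * L"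
      using loss_le ihat_I by (auto simp: loss_def Linf_nonneg)
  qed (rule loss_meas)
  have int_A: "integrable P (indicat_real A)"
    using A(1) by (intro integrable_real_indicator) (simp_all add: less_top[symmetric])
  have "expectation loss \<le> expectation (\<lambda>\<omega>. T + 2 * L * indicator A \<omega>)"
  proof (rule integral_mono)
    show "integrable P (\<lambda>\<omega>. T + 2 * L * indicator A \<omega>)"
      by (intro Bochner_Integration.integrable_add integrable_const integrable_mult_right int_A)
    fix \<omega> assume \<omega>: "\<omega> \<in> space P"
    show "loss \<omega> \<le> T + 2 * L * indicator A \<omega>"
    proof (cases "\<omega> \<in> A")
      case True
      then show ?thesis using loss_le[OF ihat_I[OF \<omega>]] T0 by (simp add: loss_def)
    next
      case False
      then show ?thesis using good \<omega> by simp
    qed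
  qed (rule int_loss)
  also have "\<dots> = T + 2 * L * prob A" using A(1) int_A by (simp add: prob_space)
  also have "\<dots> \<le> T + 2 * L * \<epsilon>" using A(2) L0 by (intro add_left_mono mult_left_mono) auto
  finally have risk: "Linf_risk P (\<lambda>\<omega>. fs (ihat \<omega>)) f \<le> T + 2 * L * \<epsilon>"
    by (simp add: Linf_risk_def loss_def)
  have "Min ((\<lambda>i. Linf (\<lambda>t. fs i t - f t)) ` I) = B"
  proof (rule Min_eqI)
    show "B \<in> (\<lambda>i. Linf (\<lambda>t. fs i t - f t)) ` I"
      using I(3) unfolding B_def Linf_diff_commute[of f] by (rule imageI)
    show "B \<le> y" if "y \<in> (\<lambda>i. Linf (\<lambda>t. fs i t - f t)) ` I" for y
      using that istar by (auto simp: B_def is_arg_min_def I_def not_less Linf_diff_commute[of f])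
  qed (use I in simp)
  with risk show ?thesis by (simp add: T_def Q_def K_def I_def)
qed

end
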